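(* Let $\beta\in\mathbb{R}$, $\tau>0$, and let $D_\pm\in\mathbb{R}^{N\times N}$ be periodic first-derivative upwind summation-by-parts (SBP) operators with diagonal mass matrix $M$. Consider the semidiscretization $$ \begin{aligned} \partial_t v &= -D_-\omega - \beta\,(v^2+w^2)\,w,\\ \partial_t w &= D_-\nu + \beta\,(v^2+w^2)\,v,\\ \tau\,\partial_t \nu &= D_+ w - \omega,\\ \tau\,\partial_t \omega &= -D_+ v + \nu, \end{aligned} $$ for the unknowns $v,w,\nu,\omega$ with values in $\mathbb{R}^N$. Then this semidiscretization conserves the discrete total mass $$\mathcal{M} = v^TMv + w^TMw + \tau\,\nu^TM\nu + \tau\,\omega^TM\omega$$ and the discrete total energy $$\mathcal{E} = 2\nu^TMD_+v - \nu^TM\nu + 2\omega^TMD_+w - \omega^TM\omega - \frac{\beta}{2}\,\mathbf{1}^TM(v^2+w^2)^2,$$ i.e., $\frac{d}{dt}\mathcal{M}=0$ and $\frac{d}{dt}\mathcal{E}=0$ along solutions.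
   Context: The system is a semidiscretization, with periodic boundary conditions, of the hyperbolized nonlinear Schrödinger equation $\mathrm{i}q^0_t+q^1_x=-\beta|q^0|^2q^0$, $\mathrm{i}\tau q^1_t-q^0_x=-q^1$, with $q^0=v+\mathrm{i}w$ and $q^1=\nu+\mathrm{i}\omega$. Notation: products and powers of vectors in $\mathbb{R}^N$ such as $v^2$, $(v^2+w^2)w$, $(v^2+w^2)^2$ are taken componentwise; $\mathbf{1}=(1,\dots,1)^T\in\mathbb{R}^N$. Definition (first-derivative upwind SBP operators): they are given by consistent first-derivative operators $D_\pm\in\mathbb{R}^{N\times N}$ (matrices consistently approximating $\partial_x$ on grid functions) and a symmetric positive definite mass (or norm) matrix $M\in\mathbb{R}^{N\times N}$ such that $$MD_+ + D_-^TM = t_Rt_R^T - t_Lt_L^T,\qquad M(D_+-D_-)\text{ is symmetric and negative semidefinite},$$ where $t_L,t_R\in\mathbb{R}^N$ are boundary restriction vectors. In the periodic case considered here, $t_L=t_R=0$, so that $MD_++D_-^TM=0$. The operators are called diagonal-norm if $M$ is diagonal. *)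

theory Defs
  imports "HOL-Analysis.Analysis"
begin

text \<open>
  Grid functions are vectors of type \<^typ>\<open>real ^ 'n\<close> with \<^term>\<open>CARD('n)\<close> nodes. On this type
  \<open>*\<close> and \<open>^\<close> act componentwise, and \<open>1\<close> is the all-ones vector.
\<close>

definition symmetric_matrix :: "real ^ 'n ^ 'n \<Rightarrow> bool" where
  "symmetric_matrix A \<longleftrightarrow> transpose A = A"

definition positive_definite :: "real ^ 'n ^ 'n \<Rightarrow> bool" where
  "positive_definite A \<longleftrightarrow> (\<forall>x. x \<noteq> 0 \<longrightarrow> x \<bullet> (A *v x) > 0)"

definition negative_semidefinite :: "real ^ 'n ^ 'n \<Rightarrow> bool" where
  "negative_semidefinite A \<longleftrightarrow> (\<forall>x. x \<bullet> (A *v x) \<le> 0)"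

definition diagonal_matrix :: "real ^ 'n ^ 'n \<Rightarrow> bool" where
  "diagonal_matrix A \<longleftrightarrow> (\<forall>i j. i \<noteq> j \<longrightarrow> A $ i $ j = 0)"

text \<open>
  For a single fixed grid, consistency with the first derivative means that constants are
  differentiated exactly. Exactness on the coordinate function \<open>x\<close> must not be demanded here:
  it is not periodic, and \<open>D\<^sub>+ x = 1\<close> together with \<open>M D\<^sub>+ + D\<^sub>-\<^sup>T M = 0\<close> and \<open>D\<^sub>- 1 = 0\<close> would give
  \<open>1\<^sup>T M 1 = 0\<close>, contradicting positive definiteness.
\<close>
definition consistent_first_derivative :: "real ^ 'n ^ 'n \<Rightarrow> bool" where
  "consistent_first_derivative D \<longleftrightarrow> D *v 1 = 0"

definition upwind_SBP ::
  "real ^ 'n ^ 'n \<Rightarrow> real ^ 'n ^ 'n \<Rightarrow> real ^ 'n ^ 'n \<Rightarrow> real ^ 'n \<Rightarrow> real ^ 'n \<Rightarrow> bool" where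
  "upwind_SBP M Dp Dm tL tR \<longleftrightarrow>
     consistent_first_derivative Dp \<and> consistent_first_derivative Dm \<and>
     symmetric_matrix M \<and> positive_definite M \<and>
     M ** Dp + transpose Dm ** M
       = (columnvector tR :: real ^ 1 ^ 'n) ** rowvector tR
         - (columnvector tL :: real ^ 1 ^ 'n) ** rowvector tL \<and>
     symmetric_matrix (M ** (Dp - Dm)) \<and> negative_semidefinite (M ** (Dp - Dm))"

definition periodic_upwind_SBP ::
  "real ^ 'n ^ 'n \<Rightarrow> real ^ 'n ^ 'n \<Rightarrow> real ^ 'n ^ 'n \<Rightarrow> bool" where
  "periodic_upwind_SBP M Dp Dm \<longleftrightarrow> upwind_SBP M Dp Dm 0 0"

definition semidiscrete_solution ::
  "real \<Rightarrow> real \<Rightarrow> real ^ 'n ^ 'n \<Rightarrow> real ^ 'n ^ 'n \<Rightarrow> real set \<Rightarrow>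
   (real \<Rightarrow> real ^ 'n) \<Rightarrow> (real \<Rightarrow> real ^ 'n) \<Rightarrow> (real \<Rightarrow> real ^ 'n) \<Rightarrow> (real \<Rightarrow> real ^ 'n) \<Rightarrow> bool" where
  "semidiscrete_solution \<beta> \<tau> Dp Dm T v w \<nu> \<omega> \<longleftrightarrow>
     (\<forall>t\<in>T. \<exists>v' w' \<nu>' \<omega>'.
        (v has_vector_derivative v') (at t within T) \<and>
        (w has_vector_derivative w') (at t within T) \<and>
        (\<nu> has_vector_derivative \<nu>') (at t within T) \<and>
        (\<omega> has_vector_derivative \<omega>') (at t within T) \<and>
        v' = - (Dm *v \<omega> t) - \<beta> *\<^sub>R (((v t)\<^sup>2 + (w t)\<^sup>2) * w t) \<and>
        w' = Dm *v \<nu> t + \<beta> *\<^sub>R (((v t)\<^sup>2 + (w t)\<^sup>2) * v t) \<and>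
        \<tau> *\<^sub>R \<nu>' = Dp *v w t - \<omega> t \<and>
        \<tau> *\<^sub>R \<omega>' = - (Dp *v v t) + \<nu> t)"

definition total_mass ::
  "real \<Rightarrow> real ^ 'n ^ 'n \<Rightarrow> real ^ 'n \<Rightarrow> real ^ 'n \<Rightarrow> real ^ 'n \<Rightarrow> real ^ 'n \<Rightarrow> real" where
  "total_mass \<tau> M v w \<nu> \<omega> =
     v \<bullet> (M *v v) + w \<bullet> (M *v w) + \<tau> * (\<nu> \<bullet> (M *v \<nu>)) + \<tau> * (\<omega> \<bullet> (M *v \<omega>))"

definition total_energy ::
  "real \<Rightarrow> real ^ 'n ^ 'n \<Rightarrow> real ^ 'n ^ 'n \<Rightarrow>
   real ^ 'n \<Rightarrow> real ^ 'n \<Rightarrow> real ^ 'n \<Rightarrow> real ^ 'n \<Rightarrow> real" where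
  "total_energy \<beta> M Dp v w \<nu> \<omega> =
     2 * (\<nu> \<bullet> (M *v (Dp *v v))) - \<nu> \<bullet> (M *v \<nu>)
     + 2 * (\<omega> \<bullet> (M *v (Dp *v w))) - \<omega> \<bullet> (M *v \<omega>)
     - \<beta> / 2 * (1 \<bullet> (M *v ((v\<^sup>2 + w\<^sup>2)\<^sup>2)))"

end

theory Submission
  imports Defs
begin

text \<open>
  The mass matrix defines the discrete inner product \<open>B x y = x \<bullet> (M *v y)\<close>. Periodic summation
  by parts says that \<open>- Dm\<close> is the \<open>B\<close>-adjoint of \<open>Dp\<close> (\<open>mass_inner_sbp\<close>), and a diagonal mass
  matrix makes multiplication by any grid function \<open>B\<close>-self-adjoint (\<open>mass_inner_mult\<close>). With
  the symmetry of \<open>B\<close>, these two facts carry the continuous conservation arguments over to the grid.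

  Mass: in \<open>B v v' + B w w' + B \<nu> (\<tau> \<nu>') + B \<omega> (\<tau> \<omega>')\<close> the terms with derivatives cancel by
  summation by parts, the cubic terms because multiplication by \<open>v\<^sup>2 + w\<^sup>2\<close> is self-adjoint, and
  the undifferentiated \<open>\<nu>\<close>, \<open>\<omega>\<close> terms by symmetry.

  Energy: the system is Hamiltonian. The partial \<open>B\<close>-gradients of the energy with respect to
  \<open>v, w, \<nu>, \<omega>\<close> are \<open>-2w', 2v', -2\<tau>\<omega>', 2\<tau>\<nu>'\<close> along a solution; summation by parts is what moves
  \<open>Dp\<close> from \<open>v\<close> to \<open>- Dm\<close> on \<open>\<nu>\<close> in the first of these, and likewise for \<open>w\<close>, while the diagonal
  mass matrix identifies the gradient of the quartic term. Pairing each gradient with the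
  corresponding time derivative produces pairs that cancel by symmetry of \<open>B\<close>.
\<close>

section \<open>The discrete inner product of the mass matrix\<close>

definition mass_inner :: "real ^ 'n ^ 'n \<Rightarrow> real ^ 'n \<Rightarrow> real ^ 'n \<Rightarrow> real" where
  "mass_inner M x y = x \<bullet> (M *v y)"

lemma mass_inner_bounded_bilinear: "bounded_bilinear (mass_inner M)"
proof -
  have "bounded_bilinear (\<lambda>x y. x \<bullet> (M *v y))"
    by (rule bounded_bilinear.comp[OF bounded_bilinear_inner bounded_linear_ident
          matrix_vector_mul_bounded_linear])
  then show ?thesis
    by (simp add: mass_inner_def[abs_def])
qed

lemmas mass_inner_simps =
  bounded_bilinear.add_left[OF mass_inner_bounded_bilinear]
  bounded_bilinear.add_right[OF mass_inner_bounded_bilinear]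
  bounded_bilinear.diff_left[OF mass_inner_bounded_bilinear]
  bounded_bilinear.diff_right[OF mass_inner_bounded_bilinear]
  bounded_bilinear.minus_left[OF mass_inner_bounded_bilinear]
  bounded_bilinear.minus_right[OF mass_inner_bounded_bilinear]
  bounded_bilinear.scaleR_left[OF mass_inner_bounded_bilinear]
  bounded_bilinear.scaleR_right[OF mass_inner_bounded_bilinear]

lemma mass_inner_commute:
  assumes "symmetric_matrix M"
  shows "mass_inner M x y = mass_inner M y x"
  using assms dot_lmul_matrix[of x M y] transpose_matrix_vector[of M x]
  by (simp add: mass_inner_def symmetric_matrix_def inner_commute)

lemma mass_inner_sbp:
  assumes "M ** Dp + transpose Dm ** M = 0"
  shows "mass_inner M x (Dp *v y) = - mass_inner M (Dm *v x) y"
proof -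
  have "(M ** Dp + transpose Dm ** M) *v y = 0"
    using assms by simp
  then have "M *v (Dp *v y) + transpose Dm *v (M *v y) = 0"
    by (simp add: matrix_vector_mult_add_rdistrib matrix_vector_mul_assoc)
  then have "x \<bullet> (M *v (Dp *v y)) + x \<bullet> (transpose Dm *v (M *v y)) = 0"
    by (metis inner_add_right inner_zero_right)
  moreover have "x \<bullet> (transpose Dm *v z) = (Dm *v x) \<bullet> z" for z
    by (metis dot_lmul_matrix inner_commute transpose_matrix_vector transpose_transpose)
  ultimately show ?thesis
    by (simp add: mass_inner_def)
qed

lemma periodic_upwind_SBP_adjoint:
  assumes "periodic_upwind_SBP M Dp Dm"
  shows "symmetric_matrix M" and "M ** Dp + transpose Dm ** M = 0"
proof -
  have "(columnvector 0 :: real ^ 1 ^ 'n) ** rowvector (0 :: real ^ 'n) = 0"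
    by (simp add: matrix_matrix_mult_def columnvector_def vec_eq_iff)
  then show "symmetric_matrix M" "M ** Dp + transpose Dm ** M = 0"
    using assms by (auto simp: periodic_upwind_SBP_def upwind_SBP_def)
qed

text \<open>
  A diagonal \<open>M\<close> acts as multiplication by a grid function, so it commutes with every other such
  multiplication. This is where the diagonal norm enters: a full norm matrix does not in general
  commute with the pointwise nonlinearity.
\<close>
lemma mass_inner_mult:
  assumes "diagonal_matrix M"
  shows "mass_inner M (p * x) y = mass_inner M x (p * y)"
proof -
  have M: "(M *v z) $ i = M $ i $ i * z $ i" for z i
  proof -
    have "(\<Sum>j\<in>UNIV. M $ i $ j * z $ j) = (\<Sum>j\<in>{i}. M $ i $ j * z $ j)"
      using assms by (intro sum.mono_neutral_right) (auto simp: diagonal_matrix_def)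
    then show ?thesis by (simp add: matrix_vector_mult_def)
  qed
  show ?thesis
    by (auto simp: mass_inner_def inner_vec_def M intro!: sum.cong)
qed

section \<open>Differentiation along curves of grid functions\<close>

lemma componentwise_mult_bounded_bilinear:
  "bounded_bilinear ((*) :: real ^ 'n \<Rightarrow> real ^ 'n \<Rightarrow> real ^ 'n)"
  by (subst bilinear_conv_bounded_bilinear[symmetric])
     (auto simp: bilinear_def algebra_simps vec_eq_iff intro!: linearI)

lemma has_vector_derivative_componentwise_power2:
  fixes f :: "real \<Rightarrow> real ^ 'n"
  assumes "(f has_vector_derivative f') (at t within T)"
  shows "((\<lambda>s. (f s)\<^sup>2) has_vector_derivative 2 *\<^sub>R (f t * f')) (at t within T)"
proof -
  have "f t * f' + f' * f t = 2 *\<^sub>R (f t * f')"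
    by (simp add: vec_eq_iff)
  then show ?thesis
    using bounded_bilinear.has_vector_derivative
      [OF componentwise_mult_bounded_bilinear assms assms]
    by (simp add: power2_eq_square)
qed

lemma has_real_derivative_mass_inner:
  assumes "(x has_vector_derivative x') (at t within T)"
    and "(y has_vector_derivative y') (at t within T)"
  shows "((\<lambda>s. mass_inner M (x s) (y s)) has_real_derivative
           mass_inner M (x t) y' + mass_inner M x' (y t)) (at t within T)"
  using bounded_bilinear.has_vector_derivative[OF mass_inner_bounded_bilinear assms]
  by (simp add: has_real_derivative_iff_has_vector_derivative)

lemma has_real_derivative_mass_inner_self:
  assumes "symmetric_matrix M"
    and "(x has_vector_derivative x') (at t within T)"
  shows "((\<lambda>s. mass_inner M (x s) (x s)) has_real_derivative 2 * mass_inner M (x t) x')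
           (at t within T)"
  using has_real_derivative_mass_inner[OF assms(2,2), of M] mass_inner_commute[OF assms(1)]
  by (metis mult_2)

lemma has_vector_derivative_matrix_vector_mult:
  fixes D :: "real ^ 'n ^ 'm"
  assumes "(x has_vector_derivative x') (at t within T)"
  shows "((\<lambda>s. D *v x s) has_vector_derivative D *v x') (at t within T)"
  using bounded_linear.has_vector_derivative[OF matrix_vector_mul_bounded_linear assms] .

section \<open>Conservation of mass and energy\<close>

lemma total_mass_eq_mass_inner:
  "total_mass \<tau> M v w \<nu> \<omega> =
     mass_inner M v v + mass_inner M w w + \<tau> * mass_inner M \<nu> \<nu> + \<tau> * mass_inner M \<omega> \<omega>"
  by (simp add: total_mass_def mass_inner_def)

text \<open>
  Moving one factor of the quartic term to the left slot turns the energy into a combination of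
  values of one bilinear form, so that the product rule applies to it directly.
\<close>
lemma total_energy_eq_mass_inner:
  assumes "diagonal_matrix M"
  shows "total_energy \<beta> M Dp v w \<nu> \<omega> =
     2 * mass_inner M \<nu> (Dp *v v) - mass_inner M \<nu> \<nu>
     + 2 * mass_inner M \<omega> (Dp *v w) - mass_inner M \<omega> \<omega>
     - \<beta> / 2 * mass_inner M (v\<^sup>2 + w\<^sup>2) (v\<^sup>2 + w\<^sup>2)"
  using mass_inner_mult[OF assms, of "v\<^sup>2 + w\<^sup>2" 1 "v\<^sup>2 + w\<^sup>2"]
  by (simp add: total_energy_def mass_inner_def power2_eq_square)

text \<open>
  Summation by parts and symmetry bring the four pairings \<open>B v v'\<close>, \<open>B w w'\<close>, \<open>B \<nu> (\<tau> \<nu>')\<close>,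
  \<open>B \<omega> (\<tau> \<omega>')\<close> to the common terms \<open>B (Dm \<omega>) v\<close>, \<open>B (Dm \<nu>) w\<close>, \<open>\<beta> B v ((v\<^sup>2 + w\<^sup>2) w)\<close> and
  \<open>B \<nu> \<omega>\<close>, each of which then occurs once with either sign.
\<close>
lemma total_mass_has_derivative_zero:
  assumes sym: "symmetric_matrix M"
    and sbp: "M ** Dp + transpose Dm ** M = 0"
    and diag: "diagonal_matrix M"
    and v: "(v has_vector_derivative v') (at t within T)"
    and w: "(w has_vector_derivative w') (at t within T)"
    and \<nu>: "(\<nu> has_vector_derivative \<nu>') (at t within T)"
    and \<omega>: "(\<omega> has_vector_derivative \<omega>') (at t within T)"
    and v': "v' = - (Dm *v \<omega> t) - \<beta> *\<^sub>R (((v t)\<^sup>2 + (w t)\<^sup>2) * w t)"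
    and w': "w' = Dm *v \<nu> t + \<beta> *\<^sub>R (((v t)\<^sup>2 + (w t)\<^sup>2) * v t)"
    and \<nu>': "\<tau> *\<^sub>R \<nu>' = Dp *v w t - \<omega> t"
    and \<omega>': "\<tau> *\<^sub>R \<omega>' = - (Dp *v v t) + \<nu> t"
  shows "((\<lambda>s. total_mass \<tau> M (v s) (w s) (\<nu> s) (\<omega> s)) has_real_derivative 0) (at t within T)"
proof -
  let ?B = "mass_inner M" and ?\<rho> = "(v t)\<^sup>2 + (w t)\<^sup>2"
  have comm: "?B x y = ?B y x" for x y
    by (rule mass_inner_commute[OF sym])
  have deriv: "((\<lambda>s. total_mass \<tau> M (v s) (w s) (\<nu> s) (\<omega> s)) has_real_derivative
          2 * ?B (v t) v' + 2 * ?B (w t) w' + \<tau> * (2 * ?B (\<nu> t) \<nu>') + \<tau> * (2 * ?B (\<omega> t) \<omega>'))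
          (at t within T)"
    unfolding total_mass_eq_mass_inner
    by (intro DERIV_add DERIV_cmult has_real_derivative_mass_inner_self[OF sym] v w \<nu> \<omega>)
  have "?B (v t) v' = - ?B (Dm *v \<omega> t) (v t) - \<beta> * ?B (v t) (?\<rho> * w t)"
    by (simp add: v' mass_inner_simps comm[of "v t" "Dm *v \<omega> t"])
  moreover have "?B (w t) w' = ?B (Dm *v \<nu> t) (w t) + \<beta> * ?B (v t) (?\<rho> * w t)"
    by (simp add: w' mass_inner_simps comm[of "w t"] mass_inner_mult[OF diag])
  moreover have "\<tau> * ?B (\<nu> t) \<nu>' = - ?B (Dm *v \<nu> t) (w t) - ?B (\<nu> t) (\<omega> t)"
  proof -
    have "\<tau> * ?B (\<nu> t) \<nu>' = ?B (\<nu> t) (\<tau> *\<^sub>R \<nu>')"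
      by (simp add: mass_inner_simps)
    then show ?thesis
      by (simp add: \<nu>' mass_inner_simps mass_inner_sbp[OF sbp])
  qed
  moreover have "\<tau> * ?B (\<omega> t) \<omega>' = ?B (Dm *v \<omega> t) (v t) + ?B (\<nu> t) (\<omega> t)"
  proof -
    have "\<tau> * ?B (\<omega> t) \<omega>' = ?B (\<omega> t) (\<tau> *\<^sub>R \<omega>')"
      by (simp add: mass_inner_simps)
    then show ?thesis
      by (simp add: \<omega>' mass_inner_simps mass_inner_sbp[OF sbp] comm[of "\<omega> t" "\<nu> t"])
  qed
  ultimately have sum0: "?B (v t) v' + ?B (w t) w' + \<tau> * ?B (\<nu> t) \<nu>' + \<tau> * ?B (\<omega> t) \<omega>' = 0"
    by linarith
  show ?thesis
    by (rule DERIV_cong[OF deriv]) (use sum0 in linarith)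
qed

text \<open>
  The Hamiltonian flow pairs \<open>v\<close> with \<open>w\<close> and \<open>\<nu>\<close> with \<open>\<omega>\<close>: each velocity is, up to a constant,
  the gradient of the energy in the partner variable, with opposite signs within a pair. The
  energy derivative therefore vanishes separately on the two pairs.
\<close>
lemma total_energy_has_derivative_zero:
  assumes sym: "symmetric_matrix M"
    and sbp: "M ** Dp + transpose Dm ** M = 0"
    and diag: "diagonal_matrix M"
    and v: "(v has_vector_derivative v') (at t within T)"
    and w: "(w has_vector_derivative w') (at t within T)"
    and \<nu>: "(\<nu> has_vector_derivative \<nu>') (at t within T)"
    and \<omega>: "(\<omega> has_vector_derivative \<omega>') (at t within T)"
    and v': "v' = - (Dm *v \<omega> t) - \<beta> *\<^sub>R (((v t)\<^sup>2 + (w t)\<^sup>2) * w t)"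
    and w': "w' = Dm *v \<nu> t + \<beta> *\<^sub>R (((v t)\<^sup>2 + (w t)\<^sup>2) * v t)"
    and \<nu>': "\<tau> *\<^sub>R \<nu>' = Dp *v w t - \<omega> t"
    and \<omega>': "\<tau> *\<^sub>R \<omega>' = - (Dp *v v t) + \<nu> t"
  shows "((\<lambda>s. total_energy \<beta> M Dp (v s) (w s) (\<nu> s) (\<omega> s)) has_real_derivative 0)
           (at t within T)"
proof -
  let ?B = "mass_inner M" and ?\<rho> = "(v t)\<^sup>2 + (w t)\<^sup>2"
  let ?\<rho>' = "2 *\<^sub>R (v t * v') + 2 *\<^sub>R (w t * w')"
  have comm: "?B x y = ?B y x" for x y
    by (rule mass_inner_commute[OF sym])
  have \<rho>: "((\<lambda>s. (v s)\<^sup>2 + (w s)\<^sup>2) has_vector_derivative ?\<rho>') (at t within T)"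
    by (intro has_vector_derivative_add has_vector_derivative_componentwise_power2 v w)
  have deriv: "((\<lambda>s. total_energy \<beta> M Dp (v s) (w s) (\<nu> s) (\<omega> s)) has_real_derivative
          2 * (?B (\<nu> t) (Dp *v v') + ?B \<nu>' (Dp *v v t)) - 2 * ?B (\<nu> t) \<nu>'
          + 2 * (?B (\<omega> t) (Dp *v w') + ?B \<omega>' (Dp *v w t)) - 2 * ?B (\<omega> t) \<omega>'
          - \<beta> / 2 * (2 * ?B ?\<rho> ?\<rho>'))
          (at t within T)"
    unfolding total_energy_eq_mass_inner[OF diag]
    by (intro DERIV_add DERIV_diff DERIV_cmult has_real_derivative_mass_inner_self[OF sym]
        has_real_derivative_mass_inner has_vector_derivative_matrix_vector_mult v w \<nu> \<omega> \<rho>)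
  have quartic: "\<beta> / 2 * (2 * ?B ?\<rho> ?\<rho>')
      = 2 * (\<beta> * ?B (?\<rho> * v t) v') + 2 * (\<beta> * ?B (?\<rho> * w t) w')"
  proof -
    have "?B ?\<rho> (x * y) = ?B (?\<rho> * x) y" for x y
      by (metis mass_inner_mult[OF diag] mult.commute)
    then have "?B ?\<rho> ?\<rho>' = 2 * ?B (?\<rho> * v t) v' + 2 * ?B (?\<rho> * w t) w'"
      by (simp only: mass_inner_simps(2,8) real_scaleR_def)
    moreover have "\<beta> / 2 * (2 * (2 * a + 2 * b)) = 2 * (\<beta> * a) + 2 * (\<beta> * b)" for a b
      by (simp add: field_simps)
    ultimately show ?thesis
      by (simp only:)
  qed
  \<comment> \<open>The \<open>B\<close>-gradients in \<open>v\<close> and \<open>w\<close> are \<open>-2w'\<close> and \<open>2v'\<close>, so the two contributions cancel.\<close>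
  have vw: "?B (\<nu> t) (Dp *v v') - \<beta> * ?B (?\<rho> * v t) v'
      + (?B (\<omega> t) (Dp *v w') - \<beta> * ?B (?\<rho> * w t) w') = 0"
  proof -
    have "?B (\<nu> t) (Dp *v v') - \<beta> * ?B (?\<rho> * v t) v' = - ?B w' v'"
      by (simp add: w' mass_inner_simps mass_inner_sbp[OF sbp])
    moreover have "?B (\<omega> t) (Dp *v w') - \<beta> * ?B (?\<rho> * w t) w' = ?B v' w'"
      by (simp add: v' mass_inner_simps mass_inner_sbp[OF sbp])
    ultimately show ?thesis
      by (simp add: comm[of w' v'])
  qed
  \<comment> \<open>Likewise the \<open>B\<close>-gradients in \<open>\<nu>\<close> and \<open>\<omega>\<close> are \<open>-2\<tau>\<omega>'\<close> and \<open>2\<tau>\<nu>'\<close>.\<close>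
  have \<nu>\<omega>: "?B \<nu>' (Dp *v v t) - ?B (\<nu> t) \<nu>' + (?B \<omega>' (Dp *v w t) - ?B (\<omega> t) \<omega>') = 0"
  proof -
    have "?B \<nu>' (Dp *v v t) - ?B (\<nu> t) \<nu>' = - ?B \<nu>' (\<tau> *\<^sub>R \<omega>')"
      unfolding \<omega>' by (simp add: mass_inner_simps comm[of "\<nu> t" \<nu>'])
    moreover have "?B \<omega>' (Dp *v w t) - ?B (\<omega> t) \<omega>' = ?B \<omega>' (\<tau> *\<^sub>R \<nu>')"
      unfolding \<nu>' by (simp add: mass_inner_simps comm[of "\<omega> t" \<omega>'])
    ultimately show ?thesis
      by (simp add: mass_inner_simps comm[of \<omega>' \<nu>'])
  qed
  have regroup: "2 * (a + b) - 2 * c + 2 * (d + e) - 2 * f - (2 * p + 2 * q)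
      = 2 * (a - p + (d - q)) + 2 * (b - c + (e - f))" for a b c d e f p q :: real
    by (simp add: algebra_simps)
  show ?thesis
    by (rule DERIV_cong[OF deriv]) (simp only: quartic regroup vw \<nu>\<omega> mult_zero_right add_0)
qed

theorem theorem5p1:
  fixes \<beta> \<tau> :: real
    and M Dp Dm :: "real ^ 'n ^ 'n"
    and T :: "real set"
    and v w \<nu> \<omega> :: "real \<Rightarrow> real ^ 'n"
  assumes "\<tau> > 0"
    and "periodic_upwind_SBP M Dp Dm"
    and "diagonal_matrix M"
    and "is_interval T"
    and "semidiscrete_solution \<beta> \<tau> Dp Dm T v w \<nu> \<omega>"
  shows "\<forall>t\<in>T.
      ((\<lambda>s. total_mass \<tau> M (v s) (w s) (\<nu> s) (\<omega> s)) has_real_derivative 0) (at t within T) \<and>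
      ((\<lambda>s. total_energy \<beta> M Dp (v s) (w s) (\<nu> s) (\<omega> s)) has_real_derivative 0) (at t within T)"
proof
  fix t assume "t \<in> T"
  note struct = periodic_upwind_SBP_adjoint[OF assms(2)] assms(3)
  from assms(5) \<open>t \<in> T\<close> obtain v' w' \<nu>' \<omega>' where
    sol: "(v has_vector_derivative v') (at t within T)"
      "(w has_vector_derivative w') (at t within T)"
      "(\<nu> has_vector_derivative \<nu>') (at t within T)"
      "(\<omega> has_vector_derivative \<omega>') (at t within T)"
      "v' = - (Dm *v \<omega> t) - \<beta> *\<^sub>R (((v t)\<^sup>2 + (w t)\<^sup>2) * w t)"
      "w' = Dm *v \<nu> t + \<beta> *\<^sub>R (((v t)\<^sup>2 + (w t)\<^sup>2) * v t)"
      "\<tau> *\<^sub>R \<nu>' = Dp *v w t - \<omega> t"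
      "\<tau> *\<^sub>R \<omega>' = - (Dp *v v t) + \<nu> t"
    unfolding semidiscrete_solution_def by blast
  show "((\<lambda>s. total_mass \<tau> M (v s) (w s) (\<nu> s) (\<omega> s)) has_real_derivative 0) (at t within T) \<and>
      ((\<lambda>s. total_energy \<beta> M Dp (v s) (w s) (\<nu> s) (\<omega> s)) has_real_derivative 0) (at t within T)"
    using total_mass_has_derivative_zero[OF struct sol]
      total_energy_has_derivative_zero[OF struct sol] by blast
qed

end
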